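(* Let $X=(X_1,\ldots,X_n)$ be a random vector in $\mathbb{R}^n$ whose components $X_1,\dots,X_n$ are independent, each having a symmetric (even) log-concave density on $\mathbb{R}$. Then \[ \mathbb{E}e^{-\Lambda^\ast_X(X)}\leqslant\big(\mathbb{E}e^{-\Lambda^\ast_Y(Y)}\big)^n, \] where $Y$ is a standard double exponential random variable, i.e. with density $\frac12 e^{-|y|}$ on $\mathbb{R}$ (numerically $\mathbb{E}e^{-\Lambda^\ast_Y(Y)}\approx 0.787$).
   Context: For a random vector $Z$ in $\mathbb{R}^n$: $\Lambda_Z(\xi)=\log\mathbb{E}e^{\langle Z,\xi\rangle}$ and $\Lambda_Z^\ast(x)=\sup_{\xi\in\mathbb{R}^n}(\langle x,\xi\rangle-\Lambda_Z(\xi))$ is the Cramér transform; $\mathbb{E}e^{-\Lambda_Z^\ast(Z)}$ denotes the expectation of $e^{-\Lambda_Z^\ast}$ evaluated at $Z$ itself. *)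

theory Defs
  imports "HOL-Probability.Probability"
begin

definition log_mgf :: "'s measure \<Rightarrow> ('s \<Rightarrow> 'a::euclidean_space) \<Rightarrow> 'a \<Rightarrow> ereal" where
  "log_mgf M Z \<xi> =
     (let m = (\<integral>\<^sup>+ \<omega>. ennreal (exp (Z \<omega> \<bullet> \<xi>)) \<partial>M)
      in if m = \<infinity> then \<infinity> else ereal (ln (enn2real m)))"

definition cramer :: "'s measure \<Rightarrow> ('s \<Rightarrow> 'a::euclidean_space) \<Rightarrow> 'a \<Rightarrow> ereal" where
  "cramer M Z x = (SUP \<xi>. ereal (x \<bullet> \<xi>) - log_mgf M Z \<xi>)"

definition exp_neg :: "ereal \<Rightarrow> real" where
  "exp_neg c = (if c = \<infinity> then 0 else exp (- real_of_ereal c))"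

definition cramer_exp :: "'s measure \<Rightarrow> ('s \<Rightarrow> 'a::euclidean_space) \<Rightarrow> real" where
  "cramer_exp M Z = (\<integral> \<omega>. exp_neg (cramer M Z (Z \<omega>)) \<partial>M)"

definition log_concave :: "(real \<Rightarrow> real) \<Rightarrow> bool" where
  "log_concave f \<longleftrightarrow> (\<forall>x. 0 \<le> f x) \<and>
     (\<forall>x y t. 0 \<le> t \<and> t \<le> 1 \<longrightarrow> f x powr t * f y powr (1 - t) \<le> f (t * x + (1 - t) * y))"

definition laplace_measure :: "real measure" where
  "laplace_measure = density lborel (\<lambda>y. ennreal (exp (- \<bar>y\<bar>) / 2))"

end

theory Submission
  imports Defs
begin

text \<open>
  Normalise a symmetric log-concave $X$ so that $E X^2 = E Y^2$. On $[0,\infty)$ the set where the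
  density of $X$ dominates that of $Y$ is an interval, because the logarithm of the latter is affine
  there. Subtracting from a convex $\phi$ its chord over the squared end points of that interval
  gives $E\,\phi(X^2) \le E\,\phi(Y^2)$. With $\phi(u) = \cosh(\xi\sqrt u)$ this yields
  $\Lambda_X \le \Lambda_Y$, hence $\Lambda_X^* \ge \Lambda_Y^*$. With $\phi(y^2) = e^{-\Lambda_Y^*(y)}$,
  which is convex in $y^2$, it yields $E e^{-\Lambda_X^*(X)} \le E e^{-\Lambda_Y^*(X)} \le E e^{-\Lambda_Y^*(Y)}$.
  In $n$ dimensions each coordinate is compared with its own rescaled $Y$, and independence turns both
  the moment generating function and the final expectation into products.
\<close>

section \<open>Convex test functions of the squared variable\<close>

text \<open>Monotonicity of secant slopes. The line \<open>c + d * u\<close> is the chord over the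
  two points; later these are the squares of the crossing points of two densities, so that
  \<open>\<phi>\<close> minus the chord changes sign exactly where the difference of the densities
  does.\<close>

lemma convex_on_chord:
  fixes \<phi> :: "real \<Rightarrow> real"
  assumes "convex_on {0..} \<phi>" "0 \<le> p" "p < q"
  obtains c d where "\<And>u. p \<le> u \<Longrightarrow> u \<le> q \<Longrightarrow> \<phi> u \<le> c + d * u"
    and "\<And>u. 0 \<le> u \<Longrightarrow> u \<le> p \<or> q \<le> u \<Longrightarrow> c + d * u \<le> \<phi> u"
proof -
  define d where "d = (\<phi> q - \<phi> p) / (q - p)"
  define c where "c = \<phi> p - d * p"
  have cq: "c + d * q = \<phi> q"
  proof -
    have "d * (q - p) = \<phi> q - \<phi> p" using assms(3) by (simp add: d_def)
    then show ?thesis by (simp add: c_def algebra_simps)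
  qed
  have "\<phi> u \<le> c + d * u" if "p \<le> u" "u \<le> q" for u
  proof -
    have "convex_on {p..q} \<phi>"
      by (rule convex_on_subset[OF assms(1)]) (use assms in auto)
    then have "\<phi> u \<le> d * (u - p) + \<phi> p"
      using convex_onD_Icc'[of p q \<phi> u] that by (simp add: d_def)
    then show ?thesis by (simp add: c_def algebra_simps)
  qed
  moreover have "c + d * u \<le> \<phi> u" if "0 \<le> u" "u \<le> p \<or> q \<le> u" for u
  proof -
    have "u = p \<or> u = q \<or> u < p \<or> q < u" using that by linarith
    then consider "u = p" | "u = q" | "u < p" | "q < u" by blast
    then show ?thesis
    proof cases
      case 3
      \<comment> \<open>The secant slope to the fixed end \<open>q\<close> grows as the other end
        moves from \<open>u\<close> to \<open>p\<close>; multiplying by the negative number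
        \<open>u - q\<close> then reverses the inequality.\<close>
      have "(\<phi> u - \<phi> q) / (u - q) \<le> (\<phi> p - \<phi> q) / (p - q)"
        using convex_on_slope_le(2)[OF assms(1), of u q p] 3 assms that by simp
      also have "\<dots> = d" unfolding d_def by (rule minus_divide_divide[of "\<phi> q - \<phi> p" "q - p", simplified])
      finally have "d * (u - q) \<le> \<phi> u - \<phi> q"
        using 3 assms by (simp add: neg_divide_le_eq)
      then show ?thesis using cq by (simp add: algebra_simps)
    next
      case 4
      have "d = (\<phi> p - \<phi> q) / (p - q)"
        unfolding d_def by (rule minus_divide_divide[of "\<phi> q - \<phi> p" "q - p", simplified, symmetric])
      also have "\<dots> \<le> (\<phi> p - \<phi> u) / (p - u)"
        using convex_on_slope_le(1)[OF assms(1), of p u q] 4 assms that by simp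
      also have "\<dots> = (\<phi> u - \<phi> p) / (u - p)"
        by (rule minus_divide_divide[of "\<phi> u - \<phi> p" "u - p", simplified])
      finally have "d * (u - p) \<le> \<phi> u - \<phi> p"
        using 4 assms by (simp add: pos_le_divide_eq)
      then show ?thesis by (simp add: c_def algebra_simps)
    qed (use cq in \<open>auto simp: c_def\<close>)
  qed
  ultimately show thesis by (rule that)
qed

text \<open>The power series of cosh has only even powers, with nonnegative coefficients. After
  inserting \<open>sqrt u\<close> it is a power series in \<open>u\<close> with nonnegative
  coefficients, and each of its terms is convex on the half-line.\<close>

lemma convex_on_cosh_sqrt: "convex_on {0..} (\<lambda>u. cosh (\<xi> * sqrt u))" for \<xi> :: real
proof (rule convex_onI)
  fix t x y :: real assume *: "0 < t" "t < 1" "x \<in> {0..}" "y \<in> {0..}"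
  \<comment> \<open>The odd terms are kept as zeros so that the indexing agrees with
    \<open>cosh_converges\<close>; convexity is then checked term by term and summed.\<close>
  define a where "a n u = (if even n then (\<xi> * sqrt u) ^ n /\<^sub>R fact n else 0)" for n u
  have sums: "(\<lambda>n. a n u) sums cosh (\<xi> * sqrt u)" for u
    unfolding a_def by (rule cosh_converges)
  have a: "a n u = \<xi> ^ n * u ^ (n div 2) / fact n" if "even n" "0 \<le> u" for n u
    using that by (auto simp: a_def power_mult_distrib power_mult divide_inverse elim!: evenE)
  have "a n ((1 - t) *\<^sub>R x + t *\<^sub>R y) \<le> (1 - t) * a n x + t * a n y" for n
  proof (cases "even n")
    case True
    have "convex_on {0..} (\<lambda>x::real. x ^ (n div 2))"
      using convex_power_odd convex_on_subset[OF convex_power_even, of _ "{0..}"] by (cases "even (n div 2)") auto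
    then have "((1 - t) *\<^sub>R x + t *\<^sub>R y) ^ (n div 2) \<le> (1 - t) * x ^ (n div 2) + t * y ^ (n div 2)"
      using * by (intro convex_onD) auto
    then have "(\<xi> ^ n / fact n) * ((1 - t) *\<^sub>R x + t *\<^sub>R y) ^ (n div 2)
        \<le> (\<xi> ^ n / fact n) * ((1 - t) * x ^ (n div 2) + t * y ^ (n div 2))"
      using True by (intro mult_left_mono) (auto simp: zero_le_even_power)
    moreover have "0 \<le> (1 - t) *\<^sub>R x + t *\<^sub>R y" using * by auto
    ultimately show ?thesis
      using True * by (simp add: a distrib_left mult.left_commute)
  qed (simp add: a_def)
  then show "cosh (\<xi> * sqrt ((1 - t) *\<^sub>R x + t *\<^sub>R y)) \<le> (1 - t) * cosh (\<xi> * sqrt x) + t * cosh (\<xi> * sqrt y)"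
    by (rule sums_le[OF _ sums sums_add[OF sums_mult[OF sums] sums_mult[OF sums]]])
qed simp

text \<open>In the variable $u = y^2$ this is $e^{-\Lambda_Y^*(y)}$ for the double exponential $Y$.
  It is not convex in $|y|$; the substitution is what makes it convex.\<close>
definition laplace_weight :: "real \<Rightarrow> real" where
  "laplace_weight u = exp (1 - sqrt (1 + u)) * (1 + sqrt (1 + u)) / 2"

text \<open>In the derivative the factor \<open>sqrt (1 + u)\<close> cancels against the inner
  derivative, leaving \<open>- exp (1 - sqrt (1 + u)) / 4\<close>, which increases with
  \<open>u\<close>.\<close>

lemma convex_on_laplace_weight: "convex_on {0..} laplace_weight"
proof (rule convex_on_realI)
  fix u :: real assume "u \<in> {0..}"
  then have "1 + u > 0" by simp
  then show "(laplace_weight has_real_derivative - exp (1 - sqrt (1 + u)) / 4) (at u)"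
    unfolding laplace_weight_def by (auto intro!: derivative_eq_intros simp: field_simps)
qed auto


section \<open>Convex order of the squares for two even densities\<close>

text \<open>A case split for the set where one density dominates the other. Whether end points
  belong to the set is left open, since they carry no mass; \<open>null\<close> covers both the
  empty set and a single point.\<close>

lemma interval_trichotomy:
  fixes S :: "real set"
  assumes "convex S" "S \<subseteq> {0..}"
  obtains (null) p where "\<And>x. x \<in> S \<Longrightarrow> x = p"
  | (ray) p where "0 \<le> p" "\<And>x. x < p \<Longrightarrow> x \<notin> S" "\<And>x. p < x \<Longrightarrow> x \<in> S"
  | (bounded) p q where "0 \<le> p" "p < q" "\<And>x. x < p \<or> q < x \<Longrightarrow> x \<notin> S"
      "\<And>x. p < x \<Longrightarrow> x < q \<Longrightarrow> x \<in> S"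
proof (cases "S = {}")
  case True
  then show ?thesis using null by blast
next
  case False
  have S: "x \<in> S" if "a \<in> S" "b \<in> S" "a \<le> x" "x \<le> b" for a b x
    using mem_is_interval_1_I[of S a b x] assms(1) that is_interval_convex_1 by blast
  define p where "p = Inf S"
  have bb: "bdd_below S" using assms(2) by (auto intro: bdd_belowI[of _ 0])
  have p0: "0 \<le> p" unfolding p_def using False assms(2) by (auto intro: cInf_greatest)
  have below: "x \<notin> S" if "x < p" for x
    using that cInf_lower[OF _ bb, of x] by (auto simp: p_def)
  have lower: "\<exists>a\<in>S. a < x" if "p < x" for x
    using that cInf_less_iff[OF False bb] by (simp add: p_def)
  show ?thesis
  proof (cases "bdd_above S")
    case True
    define q where "q = Sup S"
    have above: "x \<notin> S" if "q < x" for x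
      using that cSup_upper[OF _ True, of x] by (auto simp: q_def)
    have upper: "\<exists>b\<in>S. x < b" if "x < q" for x
      using that less_cSup_iff[OF False True] by (simp add: q_def)
    show ?thesis
    proof (cases "p < q")
      case True
      show ?thesis
      proof (rule bounded[of p q])
        show "x \<in> S" if "p < x" "x < q" for x
          using lower[OF that(1)] upper[OF that(2)] S less_imp_le by metis
      qed (use p0 True below above in auto)
    next
      case False
      then have "x = p" if "x \<in> S" for x
        using below[of x] above[of x] that by fastforce
      then show ?thesis by (rule null)
    qed
  next
    case False
    then have upper: "\<exists>b\<in>S. x < b" for x
      by (meson bdd_aboveI linorder_not_less)
    show ?thesis
    proof (rule ray[of p])
      show "x \<in> S" if "p < x" for x
        using lower[OF that] upper[of x] S less_imp_le by metis
    qed (use p0 below in auto)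
  qed
qed

text \<open>Equal mass and equal second moment make every affine function of \<open>x^2\<close>
  integrate to the same value against \<open>f\<close> and \<open>g\<close>, so the chord may be
  subtracted from \<open>\<phi>\<close>. A crossing set that is not a bounded interval of positive
  length forces the densities to agree almost everywhere.\<close>

lemma convex_order_of_squares:
  fixes f g \<phi> :: "real \<Rightarrow> real"
  assumes int: "integrable lborel f" "integrable lborel g"
      "integrable lborel (\<lambda>x. x\<^sup>2 * f x)" "integrable lborel (\<lambda>x. x\<^sup>2 * g x)"
    and mass: "(\<integral>x. f x \<partial>lborel) = (\<integral>x. g x \<partial>lborel)"
    and second: "(\<integral>x. x\<^sup>2 * f x \<partial>lborel) = (\<integral>x. x\<^sup>2 * g x \<partial>lborel)"
    and even: "\<And>x. f (- x) = f x" "\<And>x. g (- x) = g x"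
    and nonneg: "\<And>x. 0 \<le> f x"
    and cross: "convex {x. 0 \<le> x \<and> g x \<le> f x}"
    and \<phi>: "convex_on {0..} \<phi>" "\<And>u. 0 \<le> u \<Longrightarrow> 0 \<le> \<phi> u"
      "(\<lambda>x. \<phi> (x\<^sup>2)) \<in> borel_measurable borel"
    and \<phi>g: "integrable lborel (\<lambda>x. \<phi> (x\<^sup>2) * g x)"
  shows "integrable lborel (\<lambda>x. \<phi> (x\<^sup>2) * f x) \<and>
    (\<integral>x. \<phi> (x\<^sup>2) * f x \<partial>lborel) \<le> (\<integral>x. \<phi> (x\<^sup>2) * g x \<partial>lborel)"
proof -
  have [measurable]: "f \<in> borel_measurable borel" "g \<in> borel_measurable borel"
    using int(1,2)[THEN borel_measurable_integrable] by simp_all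
  note [measurable] = \<phi>(3)
  \<comment> \<open>Both degenerate shapes of the crossing set end here.\<close>
  have eq_case: ?thesis if eq: "AE x in lborel. f x = g x"
  proof -
    from eq have ae: "AE x in lborel. \<phi> (x\<^sup>2) * g x = \<phi> (x\<^sup>2) * f x" by eventually_elim simp
    have "integrable lborel (\<lambda>x. \<phi> (x\<^sup>2) * f x)"
      by (rule integrable_cong_AE_imp[OF \<phi>g _ ae]) simp
    moreover have "(\<integral>x. \<phi> (x\<^sup>2) * g x \<partial>lborel) = (\<integral>x. \<phi> (x\<^sup>2) * f x \<partial>lborel)"
      by (rule integral_cong_AE[OF _ _ ae]) simp_all
    ultimately show ?thesis by simp
  qed
  have abs_eq: "f x = f \<bar>x\<bar>" "g x = g \<bar>x\<bar>" for x
    by (auto simp: abs_real_def even)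
  from cross show ?thesis
  proof (rule interval_trichotomy)
    show "{x. 0 \<le> x \<and> g x \<le> f x} \<subseteq> {0..}" by auto
  next
    fix p assume p: "\<And>x. x \<in> {x. 0 \<le> x \<and> g x \<le> f x} \<Longrightarrow> x = p"
    \<comment> \<open>No genuine crossing: \<open>g - f\<close> is nonnegative almost everywhere
      with integral zero by equality of masses, hence zero almost everywhere.\<close>
    have ae: "AE x in lborel. 0 \<le> g x - f x"
      using AE_lborel_singleton[of p] AE_lborel_singleton[of "-p"]
    proof eventually_elim
      case (elim x)
      then have "\<bar>x\<bar> \<noteq> p" by linarith
      then have "\<not> g \<bar>x\<bar> \<le> f \<bar>x\<bar>" using p[of "\<bar>x\<bar>"] by auto
      then show ?case using abs_eq[of x] by linarith
    qed
    have "(\<integral>x. g x - f x \<partial>lborel) = 0" using int mass by simp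
    then have "AE x in lborel. g x - f x = 0"
      using integral_nonneg_eq_0_iff_AE[OF _ ae] int by simp
    then have "AE x in lborel. f x = g x" by eventually_elim simp
    then show ?thesis by (rule eq_case)
  next
    fix p :: real assume p: "0 \<le> p" "\<And>x. x < p \<Longrightarrow> x \<notin> {x. 0 \<le> x \<and> g x \<le> f x}"
      "\<And>x. p < x \<Longrightarrow> x \<in> {x. 0 \<le> x \<and> g x \<le> f x}"
    \<comment> \<open>A single crossing at \<open>p\<close>: the factors \<open>x^2 - p^2\<close>
      and \<open>f - g\<close> share their sign, yet by equal mass and second moment the product
      integrates to zero. So \<open>f = g\<close> almost everywhere, the points \<open>p\<close> and
      \<open>-p\<close> being negligible.\<close>
    have nn: "0 \<le> (x\<^sup>2 - p\<^sup>2) * (f x - g x)" for x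
    proof -
      consider "\<bar>x\<bar> = p" | "\<bar>x\<bar> < p" | "p < \<bar>x\<bar>" by linarith
      then show ?thesis
      proof cases
        case 2
        moreover have "f x \<le> g x" using p(2)[of "\<bar>x\<bar>"] 2 abs_eq[of x] by simp
        moreover have "x\<^sup>2 \<le> p\<^sup>2" using 2 p(1) by (simp add: abs_le_square_iff[symmetric])
        ultimately show ?thesis by (intro mult_nonpos_nonpos) auto
      next
        case 3
        moreover have "g x \<le> f x" using p(3)[of "\<bar>x\<bar>"] 3 abs_eq[of x] by simp
        moreover have "p\<^sup>2 \<le> x\<^sup>2" using 3 p(1) by (simp add: abs_le_square_iff[symmetric])
        ultimately show ?thesis by (intro mult_nonneg_nonneg) auto
      qed auto
    qed
    have expand: "(x\<^sup>2 - p\<^sup>2) * (f x - g x) = (x\<^sup>2 * f x - x\<^sup>2 * g x) - p\<^sup>2 * (f x - g x)" for x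
      by (simp add: algebra_simps)
    have "integrable lborel (\<lambda>x. (x\<^sup>2 - p\<^sup>2) * (f x - g x))"
      unfolding expand using int by (intro Bochner_Integration.integrable_diff integrable_mult_right) auto
    moreover have "(\<integral>x. (x\<^sup>2 - p\<^sup>2) * (f x - g x) \<partial>lborel) = 0"
      unfolding expand using int mass second by simp
    ultimately have "AE x in lborel. (x\<^sup>2 - p\<^sup>2) * (f x - g x) = 0"
      using integral_nonneg_eq_0_iff_AE[of lborel "\<lambda>x. (x\<^sup>2 - p\<^sup>2) * (f x - g x)"] nn by simp
    then have "AE x in lborel. f x = g x"
      using AE_lborel_singleton[of p] AE_lborel_singleton[of "-p"]
      by eventually_elim (auto simp: power2_eq_iff)
    then show ?thesis by (rule eq_case)
  next
    fix p q :: real assume pq: "0 \<le> p" "p < q" "\<And>x. x < p \<or> q < x \<Longrightarrow> x \<notin> {x. 0 \<le> x \<and> g x \<le> f x}"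
      "\<And>x. p < x \<Longrightarrow> x < q \<Longrightarrow> x \<in> {x. 0 \<le> x \<and> g x \<le> f x}"
    have out: "f x \<le> g x" if "\<bar>x\<bar> < p \<or> q < \<bar>x\<bar>" for x
      using pq(3)[OF that] abs_eq[of x] by simp
    have inside: "g x \<le> f x" if "p < \<bar>x\<bar>" "\<bar>x\<bar> < q" for x
      using pq(4)[OF that] abs_eq[of x] by simp
    have "p\<^sup>2 < q\<^sup>2" using pq by (simp add: power_strict_mono)
    then obtain c d where cd: "\<And>u. p\<^sup>2 \<le> u \<Longrightarrow> u \<le> q\<^sup>2 \<Longrightarrow> \<phi> u \<le> c + d * u"
       "\<And>u. 0 \<le> u \<Longrightarrow> u \<le> p\<^sup>2 \<or> q\<^sup>2 \<le> u \<Longrightarrow> c + d * u \<le> \<phi> u"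
      using convex_on_chord[OF \<phi>(1), of "p\<^sup>2" "q\<^sup>2"] by auto
    \<comment> \<open>The two factors have opposite signs inside and outside the interval. At its
      end points the sign of \<open>f - g\<close> is unknown, but there the chord meets
      \<open>\<phi>\<close> and the first factor vanishes.\<close>
    have np: "(\<phi> (x\<^sup>2) - (c + d * x\<^sup>2)) * (f x - g x) \<le> 0" for x
    proof -
      have sq: "\<bar>x\<bar> \<le> r \<longleftrightarrow> x\<^sup>2 \<le> r\<^sup>2" "r \<le> \<bar>x\<bar> \<longleftrightarrow> r\<^sup>2 \<le> x\<^sup>2" if "0 \<le> r" for r
        using abs_le_square_iff[of x r] abs_le_square_iff[of r x] that by auto
      consider "\<bar>x\<bar> = p \<or> \<bar>x\<bar> = q" | "\<bar>x\<bar> < p \<or> q < \<bar>x\<bar>" | "p < \<bar>x\<bar>" "\<bar>x\<bar> < q" by linarith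
      then show ?thesis
      proof cases
        case 1
        then have "x\<^sup>2 = p\<^sup>2 \<or> x\<^sup>2 = q\<^sup>2" by (metis power2_abs)
        then have "\<phi> (x\<^sup>2) = c + d * x\<^sup>2"
          using cd(1)[of "x\<^sup>2"] cd(2)[of "x\<^sup>2"] \<open>p\<^sup>2 < q\<^sup>2\<close> by (intro antisym) auto
        then show ?thesis by simp
      next
        case 2
        have "f x \<le> g x" using out 2 by blast
        moreover have "x\<^sup>2 \<le> p\<^sup>2 \<or> q\<^sup>2 \<le> x\<^sup>2" using 2 sq(1)[of p] sq(2)[of q] pq(1,2) by linarith
        ultimately show ?thesis using cd(2)[of "x\<^sup>2"] by (intro mult_nonneg_nonpos) auto
      next
        case 3
        have "g x \<le> f x" using inside 3 by blast
        moreover have "p\<^sup>2 \<le> x\<^sup>2" "x\<^sup>2 \<le> q\<^sup>2" using 3 sq(2)[of p] sq(1)[of q] pq(1,2) by linarith+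
        ultimately show ?thesis using cd(1)[of "x\<^sup>2"] by (intro mult_nonpos_nonneg) auto
      qed
    qed
    \<comment> \<open>\<open>R\<close> is \<open>\<phi> (x^2) * g x\<close> plus the chord
      integrated against \<open>f - g\<close>. It dominates \<open>\<phi> (x^2) * f x\<close>, is
      integrable, and has the same integral as \<open>\<phi> (x^2) * g x\<close>, so it yields
      integrability and the inequality together.\<close>
    define R where "R x = \<phi> (x\<^sup>2) * g x + (c * f x + d * (x\<^sup>2 * f x)) - (c * g x + d * (x\<^sup>2 * g x))" for x
    have le: "\<phi> (x\<^sup>2) * f x \<le> R x" for x
      using np[of x] by (simp add: R_def algebra_simps)
    have intR: "integrable lborel R"
      unfolding R_def using int \<phi>g by auto
    have "integrable lborel (\<lambda>x. \<phi> (x\<^sup>2) * f x)"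
    proof (rule Bochner_Integration.integrable_bound[OF intR])
      show "AE x in lborel. norm (\<phi> (x\<^sup>2) * f x) \<le> norm (R x)"
      proof (rule AE_I2)
        fix x have "0 \<le> \<phi> (x\<^sup>2) * f x" using \<phi>(2) nonneg by simp
        then show "norm (\<phi> (x\<^sup>2) * f x) \<le> norm (R x)" using le[of x] by simp
      qed
    qed simp
    moreover from this have "(\<integral>x. \<phi> (x\<^sup>2) * f x \<partial>lborel) \<le> (\<integral>x. R x \<partial>lborel)"
      using intR le by (intro integral_mono)
    moreover have "(\<integral>x. R x \<partial>lborel) = (\<integral>x. \<phi> (x\<^sup>2) * g x \<partial>lborel)"
      unfolding R_def using int \<phi>g mass second by simp
    ultimately show ?thesis by simp
  qed
qed

section \<open>Integrals against the double exponential density\<close>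

lemma has_bochner_integral_exp_Ici:
  fixes c :: real
  assumes "0 < c"
  shows "has_bochner_integral lborel (\<lambda>x. indicator {0..} x * exp (- (c * x))) (1 / c)"
proof -
  have "has_bochner_integral lborel (\<lambda>x. (c * x) ^ 0 * exp (- (c * x)) * indicator {0..} (c * x)) (1 / c)"
    using assms lborel_has_bochner_integral_real_affine_iff[of c
        "\<lambda>x. x ^ 0 * exp (- x) * indicator {0..} x" 1 0] has_bochner_integral_I0i_power_exp_m'[of 0]
    by (simp add: divide_inverse)
  also have "(\<lambda>x. (c * x) ^ 0 * exp (- (c * x)) * indicator {0..} (c * x)) =
      (\<lambda>x. indicator {0..} x * exp (- (c * x)))"
    using assms by (auto simp: fun_eq_iff zero_le_mult_iff split: split_indicator)
  finally show ?thesis .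
qed

text \<open>On the half-line the integrand splits into exponentials with rates
  \<open>1 - \<xi>\<close> and \<open>1 + \<xi>\<close>; evenness doubles the result. The case
  \<open>\<xi> = 0\<close> supplies the total mass.\<close>

lemma laplace_cosh:
  fixes \<xi> :: real
  assumes "\<bar>\<xi>\<bar> < 1"
  shows "has_bochner_integral lborel (\<lambda>x. cosh (\<xi> * x) * (exp (- \<bar>x\<bar>) / 2)) (1 / (1 - \<xi>\<^sup>2))"
proof -
  have "has_bochner_integral lborel (\<lambda>x. (indicator {0..} x * exp (- ((1 - \<xi>) * x)) +
      indicator {0..} x * exp (- ((1 + \<xi>) * x))) / 4) ((1 / (1 - \<xi>) + 1 / (1 + \<xi>)) / 4)"
    using assms by (intro has_bochner_integral_divide_zero has_bochner_integral_add has_bochner_integral_exp_Ici) auto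
  also have "(\<lambda>x. (indicator {0..} x * exp (- ((1 - \<xi>) * x)) + indicator {0..} x * exp (- ((1 + \<xi>) * x))) / 4) =
      (\<lambda>x. indicator {0..} x *\<^sub>R (cosh (\<xi> * x) * (exp (- \<bar>x\<bar>) / 2)))"
    by (auto simp: fun_eq_iff cosh_def mult_exp_exp algebra_simps add_divide_distrib split: split_indicator)
  finally have "has_bochner_integral lborel (\<lambda>x. cosh (\<xi> * x) * (exp (- \<bar>x\<bar>) / 2))
      (2 *\<^sub>R ((1 / (1 - \<xi>) + 1 / (1 + \<xi>)) / 4))"
    by (rule has_bochner_integral_even_function) simp
  also have "2 *\<^sub>R ((1 / (1 - \<xi>) + 1 / (1 + \<xi>)) / 4) = 1 / ((1 - \<xi>) * (1 + \<xi>))"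
  proof -
    have "1 / (1 - \<xi>) + 1 / (1 + \<xi>) = 2 / ((1 - \<xi>) * (1 + \<xi>))"
      using assms by (simp add: add_frac_eq)
    then show ?thesis by simp
  qed
  also have "(1 - \<xi>) * (1 + \<xi>) = 1 - \<xi>\<^sup>2"
    by (simp add: algebra_simps power2_eq_square)
  finally show ?thesis .
qed

lemma laplace_second_moment:
  "has_bochner_integral lborel (\<lambda>x::real. x\<^sup>2 * (exp (- \<bar>x\<bar>) / 2)) 2"
proof -
  have "has_bochner_integral lborel (\<lambda>x::real. x ^ 2 * exp (- x) * indicator {0..} x / 2) (fact 2 / 2)"
    by (intro has_bochner_integral_divide_zero has_bochner_integral_I0i_power_exp_m')
  also have "(\<lambda>x::real. x ^ 2 * exp (- x) * indicator {0..} x / 2) =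
      (\<lambda>x. indicator {0..} x *\<^sub>R (x\<^sup>2 * (exp (- \<bar>x\<bar>) / 2)))"
    by (auto split: split_indicator)
  finally have "has_bochner_integral lborel (\<lambda>x::real. x\<^sup>2 * (exp (- \<bar>x\<bar>) / 2)) (2 *\<^sub>R (fact 2 / 2))"
    by (rule has_bochner_integral_even_function) simp
  then show ?thesis by simp
qed

text \<open>If Y is double exponential, \<open>l * exp (- (l * \<bar>x\<bar>)) / 2\<close> is the
  density of Y / l, so the expectation of \<open>F (l * x)\<close> under it is that of F(Y).\<close>

lemma laplace_scale:
  fixes l :: real and F :: "real \<Rightarrow> real"
  assumes "0 < l" "has_bochner_integral lborel (\<lambda>x. F x * (exp (- \<bar>x\<bar>) / 2)) I"
  shows "has_bochner_integral lborel (\<lambda>x. F (l * x) * (l * exp (- (l * \<bar>x\<bar>)) / 2)) I"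
proof -
  have "has_bochner_integral lborel (\<lambda>x. F (l * x) * (exp (- \<bar>l * x\<bar>) / 2)) (I / l)"
    using iffD1[OF lborel_has_bochner_integral_real_affine_iff[of l _ _ 0] assms(2)] assms(1)
    by (simp add: divide_inverse_commute[of I])
  from has_bochner_integral_mult_right[of l, OF this] show ?thesis
    using assms(1) by (simp add: abs_mult mult_ac)
qed

section \<open>Symmetric log-concave densities: decay and second moment\<close>

lemma log_concaveD:
  assumes "log_concave f"
  shows "0 \<le> f x"
    and "0 \<le> t \<Longrightarrow> t \<le> 1 \<Longrightarrow> f x powr t * f y powr (1 - t) \<le> f (t * x + (1 - t) * y)"
  using assms by (simp_all add: log_concave_def)

lemma log_concave_even_antimono:
  assumes "log_concave f" "\<And>x. f (- x) = f x" "\<bar>x\<bar> \<le> \<bar>y\<bar>"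
  shows "f y \<le> f x"
proof (cases "y = 0")
  case True
  then show ?thesis using assms(3) by simp
next
  case False
  \<comment> \<open>The weight that writes \<open>x\<close> as a convex combination of
    \<open>y\<close> and \<open>- y\<close>. As \<open>f\<close> takes the same value at both, their
    geometric mean is \<open>f y\<close> itself.\<close>
  define t where "t = (x / y + 1) / 2"
  have "\<bar>x / y\<bar> \<le> 1" using assms(3) False by simp
  then have "x / y \<le> 1" "- (x / y) \<le> 1" unfolding abs_le_iff by simp_all
  then have t: "0 \<le> t" "t \<le> 1" by (auto simp: t_def)
  have "t * y + (1 - t) * (- y) = (2 * t - 1) * y" by (simp add: algebra_simps)
  also have "2 * t - 1 = x / y" by (simp add: t_def field_simps)
  also have "x / y * y = x" using False by simp
  finally have "f y powr t * f (- y) powr (1 - t) \<le> f x"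
    using log_concaveD(2)[OF assms(1) t, of y "- y"] by simp
  moreover have "f y powr t * f y powr (1 - t) = f y"
    using log_concaveD(1)[OF assms(1)] by (simp add: powr_add[symmetric])
  ultimately show ?thesis using assms(2) by simp
qed

text \<open>Once \<open>f\<close> has dropped below \<open>f 0\<close> at some \<open>a\<close>,
  concavity of \<open>ln f\<close> makes it fall at least linearly beyond \<open>a\<close>, with the
  slope reached between 0 and \<open>a\<close>.\<close>

lemma log_concave_even_exponential_tail:
  assumes lc: "log_concave f" and even: "\<And>x. f (- x) = f x" and int: "integrable lborel f"
  obtains C c where "0 < c" "\<And>x. f x \<le> C * exp (- (c * \<bar>x\<bar>))"
proof (cases "f 0 = 0")
  case True
  then have "f x \<le> 0 * exp (- (1 * \<bar>x\<bar>))" for x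
    using log_concave_even_antimono[OF lc even, of 0 x] by simp
  then show ?thesis by (rule that[rotated]) simp
next
  case False
  have nonneg: "0 \<le> f x" for x using lc by (simp add: log_concave_def)
  have f0: "0 < f 0" using False nonneg[of 0] by simp
  \<comment> \<open>Otherwise \<open>f\<close> would be a positive constant, which is not
    integrable.\<close>
  have "\<exists>x>0. f x < f 0"
  proof (rule ccontr)
    assume "\<not> (\<exists>x>0. f x < f 0)"
    then have pos: "f x = f 0" if "0 < x" for x
      using that log_concave_even_antimono[OF lc even, of 0 x] by fastforce
    have "f x = f 0" for x
      using pos[of x] pos[of "- x"] even[of x] by (cases "x = 0") (auto simp: neq_iff)
    then have "f = (\<lambda>x. f 0)" by blast
    then have "integrable lborel (\<lambda>x::real. f 0)" using int by simp
    then show False using f0 by (auto simp: integrable_iff_bounded ennreal_mult_eq_top_iff)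
  qed
  then obtain a where a: "0 < a" "f a < f 0" by blast
  \<comment> \<open>The maximum with \<open>f 0 / 2\<close> keeps the logarithm meaningful when
    \<open>f a\<close> is zero, while \<open>m\<close> stays below \<open>f 0\<close>.\<close>
  define m where "m = max (f a) (f 0 / 2)"
  have m: "0 < m" "m < f 0" "f a \<le> m" using f0 a by (auto simp: m_def)
  \<comment> \<open>The rate of decay of \<open>ln\<close> from \<open>f 0\<close> to the level
    \<open>m\<close> over the distance \<open>a\<close>.\<close>
  define c where "c = ln (f 0 / m) / a"
  have c: "0 < c" using m a by (simp add: c_def)
  \<comment> \<open>The factor \<open>exp (c * a)\<close> makes the bound at least
    \<open>f 0\<close> for \<open>\<bar>x\<bar> \<le> a\<close>, where only monotonicity is
    available.\<close>
  have "f x \<le> (f 0 * exp (c * a)) * exp (- (c * \<bar>x\<bar>))" for x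
  proof -
    consider "f x = 0" | "\<bar>x\<bar> \<le> a" | "f x \<noteq> 0" "a < \<bar>x\<bar>" by linarith
    then show ?thesis
    proof cases
      case 1
      then show ?thesis using f0 by simp
    next
      case 2
      then have "1 \<le> exp (c * a - c * \<bar>x\<bar>)" using c by (simp add: mult_left_mono)
      then have "f 0 * 1 \<le> f 0 * exp (c * a - c * \<bar>x\<bar>)" using f0 by (intro mult_left_mono) auto
      moreover have "f x \<le> f 0" by (rule log_concave_even_antimono[OF lc even]) simp
      moreover have "f 0 * exp (c * a - c * \<bar>x\<bar>) = (f 0 * exp (c * a)) * exp (- (c * \<bar>x\<bar>))"
        by (simp add: mult_exp_exp)
      ultimately show ?thesis by linarith
    next
      case 3
      \<comment> \<open>Places \<open>a\<close> on the segment from 0 to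
        \<open>\<bar>x\<bar>\<close>: log-concavity at \<open>a\<close>, where
        \<open>f a \<le> m\<close>, then turns into an upper bound on
        \<open>f \<bar>x\<bar>\<close>.\<close>
      define t where "t = a / \<bar>x\<bar>"
      have t: "0 < t" "t < 1" using 3 a by (auto simp: t_def)
      have fx: "0 < f \<bar>x\<bar>" "f \<bar>x\<bar> = f x" using 3 nonneg[of x] even[of x] by (auto simp: abs_real_def)
      have "f \<bar>x\<bar> powr t * f 0 powr (1 - t) \<le> f (t * \<bar>x\<bar> + (1 - t) * 0)"
        using t by (intro log_concaveD(2)[OF lc]) auto
      also have "t * \<bar>x\<bar> + (1 - t) * 0 = a" using 3 a by (simp add: t_def)
      finally have "f \<bar>x\<bar> powr t * f 0 powr (1 - t) \<le> m" using m by simp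
      then have "ln (f \<bar>x\<bar> powr t * f 0 powr (1 - t)) \<le> ln m"
        using fx f0 by (subst ln_le_cancel_iff) (auto simp: m)
      then have "t * ln (f \<bar>x\<bar>) + (1 - t) * ln (f 0) \<le> ln m"
        using fx f0 by (simp add: ln_mult ln_powr)
      then have "t * ln (f \<bar>x\<bar>) \<le> t * ln (f 0) - c * a"
      proof -
        have "c * a = ln (f 0) - ln m" using m a f0 by (simp add: c_def ln_div)
        then show ?thesis using \<open>t * ln (f \<bar>x\<bar>) + (1 - t) * ln (f 0) \<le> ln m\<close>
          by (simp add: algebra_simps)
      qed
      also have "c * a = t * (c * \<bar>x\<bar>)" using 3 a by (simp add: t_def)
      finally have "t * ln (f \<bar>x\<bar>) \<le> t * (ln (f 0) - c * \<bar>x\<bar>)" by (simp add: algebra_simps)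
      then have "ln (f \<bar>x\<bar>) \<le> ln (f 0) - c * \<bar>x\<bar>" using t by simp
      then have "f \<bar>x\<bar> \<le> exp (ln (f 0) - c * \<bar>x\<bar>)" using fx by (metis exp_le_cancel_iff exp_ln)
      also have "\<dots> = f 0 * exp (- (c * \<bar>x\<bar>))" using f0 by (simp add: exp_diff exp_minus field_simps)
      also have "\<dots> \<le> (f 0 * exp (c * a)) * exp (- (c * \<bar>x\<bar>))"
        using f0 c a by (intro mult_right_mono) auto
      finally show ?thesis using fx by simp
    qed
  qed
  then show ?thesis using c that by blast
qed

text \<open>Finiteness comes from the exponential tail. If the moment were zero, \<open>f\<close>
  would vanish almost everywhere, against its nonzero mass.\<close>

lemma log_concave_even_second_moment:
  assumes lc: "log_concave f" and even: "\<And>x. f (- x) = f x" and int: "integrable lborel f"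
    and pos: "(\<integral>x. f x \<partial>lborel) \<noteq> 0"
  shows "integrable lborel (\<lambda>x. x\<^sup>2 * f x)" "0 < (\<integral>x. x\<^sup>2 * f x \<partial>lborel)"
proof -
  have [measurable]: "f \<in> borel_measurable borel"
    using borel_measurable_integrable[OF int] by simp
  have nonneg: "0 \<le> f x" for x using lc by (simp add: log_concave_def)
  obtain c C where c: "0 < c" and tail: "\<And>x. f x \<le> C * exp (- (c * \<bar>x\<bar>))"
    by (rule log_concave_even_exponential_tail[OF lc even int]) (rule that)
  have "integrable lborel (\<lambda>x. (c * x)\<^sup>2 * (c * exp (- (c * \<bar>x\<bar>)) / 2))"
    by (rule integrable.intros[OF laplace_scale[OF c laplace_second_moment]])
  \<comment> \<open>The constant trades the normalisation and scaling of the double exponential for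
    the prefactor \<open>C\<close> of the tail bound.\<close>
  then have "integrable lborel (\<lambda>x. (2 * C / c ^ 3) * ((c * x)\<^sup>2 * (c * exp (- (c * \<bar>x\<bar>)) / 2)))"
    by (rule integrable_mult_right)
  also have "(\<lambda>x. (2 * C / c ^ 3) * ((c * x)\<^sup>2 * (c * exp (- (c * \<bar>x\<bar>)) / 2))) =
      (\<lambda>x. x\<^sup>2 * (C * exp (- (c * \<bar>x\<bar>))))"
    using c by (simp add: fun_eq_iff power_mult_distrib power2_eq_square power3_eq_cube)
  finally show int2: "integrable lborel (\<lambda>x. x\<^sup>2 * f x)"
  proof (rule Bochner_Integration.integrable_bound)
    show "AE x in lborel. norm (x\<^sup>2 * f x) \<le> norm (x\<^sup>2 * (C * exp (- (c * \<bar>x\<bar>))))"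
    proof (rule AE_I2)
      fix x :: real
      have "x\<^sup>2 * f x \<le> x\<^sup>2 * (C * exp (- (c * \<bar>x\<bar>)))" by (intro mult_left_mono tail) simp
      moreover have "0 \<le> x\<^sup>2 * f x" using nonneg by simp
      ultimately show "norm (x\<^sup>2 * f x) \<le> norm (x\<^sup>2 * (C * exp (- (c * \<bar>x\<bar>))))" by simp
    qed
  qed simp
  have "(\<integral>x. x\<^sup>2 * f x \<partial>lborel) \<noteq> 0"
  proof
    assume "(\<integral>x. x\<^sup>2 * f x \<partial>lborel) = 0"
    then have "AE x in lborel. x\<^sup>2 * f x = 0"
      using integral_nonneg_eq_0_iff_AE[OF int2] nonneg by simp
    then have "AE x in lborel. f x = 0"
      using AE_lborel_singleton[of 0] by eventually_elim simp
    then have "(\<integral>x. f x \<partial>lborel) = 0" by (rule integral_eq_zero_AE)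
    then show False using pos by simp
  qed
  moreover have "0 \<le> (\<integral>x. x\<^sup>2 * f x \<partial>lborel)" using nonneg by simp
  ultimately show "0 < (\<integral>x. x\<^sup>2 * f x \<partial>lborel)" by simp
qed

text \<open>On the half-line a weighted geometric mean of values of the exponential is its value at
  the weighted mean, so the lower bound survives the log-concavity inequality. Working with powers
  instead of logarithms accommodates zeros of \<open>f\<close>.\<close>

lemma log_concave_above_exponential_convex:
  assumes "log_concave f" "0 < A"
  shows "convex {x. 0 \<le> x \<and> A * exp (- (l * \<bar>x\<bar>)) \<le> f x}"
proof (rule convexI)
  fix x y t s :: real
  assume "x \<in> {x. 0 \<le> x \<and> A * exp (- (l * \<bar>x\<bar>)) \<le> f x}"
    "y \<in> {x. 0 \<le> x \<and> A * exp (- (l * \<bar>x\<bar>)) \<le> f x}" "0 \<le> t" "0 \<le> s" "t + s = 1"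
  then have *: "0 \<le> x" "0 \<le> y" "0 \<le> t" "t \<le> 1" "s = 1 - t"
    "A * exp (- (l * x)) \<le> f x" "A * exp (- (l * y)) \<le> f y" by auto
  define z where "z = t * x + s * y"
  have z: "0 \<le> z" using * by (simp add: z_def)
  have A: "A powr t * A powr s = A" using assms(2) * by (simp add: powr_add[symmetric])
  have E: "exp (- (l * x)) powr t * exp (- (l * y)) powr s = exp (- (l * z))"
    by (simp add: exp_powr_real mult_exp_exp z_def algebra_simps)
  have "(A * exp (- (l * x))) powr t * (A * exp (- (l * y))) powr s
      = (A powr t * A powr s) * (exp (- (l * x)) powr t * exp (- (l * y)) powr s)"
    using assms(2) by (simp only: powr_mult mult_ac)
  also have "\<dots> = A * exp (- (l * z))" by (simp only: A E)
  finally have "A * exp (- (l * z)) = (A * exp (- (l * x))) powr t * (A * exp (- (l * y))) powr s" ..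
  also have "\<dots> \<le> f x powr t * f y powr s"
    using * assms(2) by (intro mult_mono powr_mono2) auto
  also have "\<dots> \<le> f z"
    using log_concaveD(2)[OF assms(1), of t x y] * by (simp add: z_def)
  finally show "t *\<^sub>R x + s *\<^sub>R y \<in> {x. 0 \<le> x \<and> A * exp (- (l * \<bar>x\<bar>)) \<le> f x}"
    using z by (simp add: z_def)
qed

section \<open>The weight \<open>laplace_weight\<close> and the Legendre dual of
  \<open>- ln (1 - \<xi>^2)\<close>\<close>

lemma laplace_weight_nonneg: "0 \<le> u \<Longrightarrow> 0 \<le> laplace_weight u"
  by (simp add: laplace_weight_def)

lemma laplace_weight_pos: "0 \<le> u \<Longrightarrow> 0 < laplace_weight u"
  by (simp add: laplace_weight_def add_pos_nonneg)

text \<open>With \<open>s = sqrt (1 + u)\<close> this is \<open>1 + v \<le> exp v\<close> at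
  \<open>v = s - 1\<close>, using \<open>(1 + s) / 2 \<le> s\<close>. It makes the weight integrable
  against any probability density.\<close>

lemma laplace_weight_le_1:
  assumes "0 \<le> u"
  shows "laplace_weight u \<le> 1"
proof -
  define s where "s = sqrt (1 + u)"
  have "1 \<le> s" using assms by (simp add: s_def)
  then have "(1 + s) / 2 \<le> 1 + (s - 1)" by simp
  also have "\<dots> \<le> exp (s - 1)" by (rule exp_ge_add_one_self)
  finally have "(1 + s) / 2 \<le> exp (s - 1)" .
  then have "exp (1 - s) * ((1 + s) / 2) \<le> exp (1 - s) * exp (s - 1)"
    by (intro mult_left_mono) simp_all
  also have "\<dots> = 1" by (simp add: mult_exp_exp)
  finally show ?thesis by (simp add: laplace_weight_def s_def)
qed

lemma borel_measurable_laplace_weight [measurable]: "laplace_weight \<in> borel_measurable borel"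
  unfolding laplace_weight_def by measurable

lemma convex_on_laplace_weight_scaled:
  assumes "0 \<le> c"
  shows "convex_on {0..} (\<lambda>u. laplace_weight (c * u))"
proof (rule convex_onI)
  fix t x y :: real assume *: "0 < t" "t < 1" "x \<in> {0..}" "y \<in> {0..}"
  have "laplace_weight ((1 - t) *\<^sub>R (c * x) + t *\<^sub>R (c * y)) \<le> (1 - t) * laplace_weight (c * x) + t * laplace_weight (c * y)"
    using * assms by (intro convex_onD[OF convex_on_laplace_weight]) auto
  then show "laplace_weight (c * ((1 - t) *\<^sub>R x + t *\<^sub>R y)) \<le> (1 - t) * laplace_weight (c * x) + t * laplace_weight (c * y)"
    by (simp add: algebra_simps)
qed simp

text \<open>The maximiser of $\xi \mapsto x\xi + \ln(1 - \xi^2)$, written without a removable singularity at $0$.\<close>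
definition dual_point :: "real \<Rightarrow> real" where
  "dual_point x = x / (1 + sqrt (1 + x\<^sup>2))"

lemma dual_point_identities:
  defines "s \<equiv> \<lambda>x. sqrt (1 + x\<^sup>2)"
  shows "x * dual_point x = s x - 1" "1 - (dual_point x)\<^sup>2 = 2 / (1 + s x)" "\<bar>dual_point x\<bar> < 1"
proof -
  have s: "1 \<le> s x" "(s x)\<^sup>2 = 1 + x\<^sup>2" by (simp_all add: s_def)
  have d: "dual_point x = x / (1 + s x)" by (simp add: dual_point_def s_def)
  \<comment> \<open>The factorisation of \<open>s^2 - 1 = x^2\<close> is the source of all three
    identities.\<close>
  have "x * x = (s x - 1) * (1 + s x)" using s(2) by (simp add: algebra_simps power2_eq_square)
  then show 1: "x * dual_point x = s x - 1"
    using s by (simp add: d)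
  have "(dual_point x)\<^sup>2 = (x * dual_point x) / (1 + s x)"
    by (simp add: d power2_eq_square)
  also have "\<dots> = (s x - 1) / (1 + s x)" by (simp only: 1)
  finally show 2: "1 - (dual_point x)\<^sup>2 = 2 / (1 + s x)"
    using s(1) by (simp add: field_simps)
  have "0 < 1 - (dual_point x)\<^sup>2" unfolding 2 using s(1) by simp
  then show "\<bar>dual_point x\<bar> < 1" by (simp add: abs_square_less_1[symmetric])
qed

lemma dual_point_attains: "x * dual_point x + ln (1 - (dual_point x)\<^sup>2) = - ln (laplace_weight (x\<^sup>2))"
proof -
  define s where "s = sqrt (1 + x\<^sup>2)"
  have s: "1 \<le> s" by (simp add: s_def)
  have "ln (laplace_weight (x\<^sup>2)) = (1 - s) + ln ((1 + s) / 2)"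
    unfolding laplace_weight_def s_def[symmetric] using s
    by (subst times_divide_eq_right[symmetric], subst ln_mult) auto
  moreover have "ln (2 / (1 + s)) = - ln ((1 + s) / 2)"
    using s by (simp add: ln_div)
  ultimately show ?thesis
    using dual_point_identities(1,2)[of x] by (simp add: s_def)
qed

text \<open>Optimality of \<open>dual_point\<close> without calculus:
  \<open>ln r \<le> r - 1\<close> at the ratio of \<open>1 - \<xi>^2\<close> to
  \<open>1 - p^2\<close> linearises the logarithm, and what remains is a nonnegative multiple of
  \<open>(p - \<xi>)^2\<close>.\<close>

lemma dual_bound:
  assumes "\<bar>\<xi>\<bar> < 1"
  shows "x * \<xi> + ln (1 - \<xi>\<^sup>2) \<le> - ln (laplace_weight (x\<^sup>2))"
proof -
  define p where "p = dual_point x"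
  define s where "s = sqrt (1 + x\<^sup>2)"
  have s: "1 \<le> s" by (simp add: s_def)
  have p: "x * p = s - 1" "1 - p\<^sup>2 = 2 / (1 + s)"
    using dual_point_identities[of x] by (simp_all add: p_def s_def)
  have x: "x = p * (1 + s)" using s by (simp add: p_def dual_point_def s_def[symmetric])
  have pos: "0 < 1 - \<xi>\<^sup>2" "0 < 1 - p\<^sup>2"
    using assms dual_point_identities(3)[of x] by (simp_all add: abs_square_less_1 p_def)
  have "ln (1 - \<xi>\<^sup>2) - ln (1 - p\<^sup>2) = ln ((1 - \<xi>\<^sup>2) / (1 - p\<^sup>2))"
    using pos by (simp add: ln_div)
  also have "\<dots> \<le> (1 - \<xi>\<^sup>2) / (1 - p\<^sup>2) - 1"
    using pos by (intro ln_le_minus_one) simp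
  also have "\<dots> = (p\<^sup>2 - \<xi>\<^sup>2) / (1 - p\<^sup>2)"
    using pos by (simp add: field_simps)
  also have "\<dots> = (p\<^sup>2 - \<xi>\<^sup>2) * (1 + s) / 2"
    unfolding p(2) by simp
  finally have "ln (1 - \<xi>\<^sup>2) - ln (1 - p\<^sup>2) \<le> (p\<^sup>2 - \<xi>\<^sup>2) * (1 + s) / 2" .
  moreover have "x * p - x * \<xi> - (p\<^sup>2 - \<xi>\<^sup>2) * (1 + s) / 2 = (1 + s) * (p - \<xi>)\<^sup>2 / 2"
    unfolding x by (simp add: field_simps power2_eq_square)
  moreover have "0 \<le> (1 + s) * (p - \<xi>)\<^sup>2 / 2" using s by simp
  ultimately have "x * \<xi> + ln (1 - \<xi>\<^sup>2) \<le> x * p + ln (1 - p\<^sup>2)" by linarith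
  also have "\<dots> = - ln (laplace_weight (x\<^sup>2))" unfolding p_def by (rule dual_point_attains)
  finally show ?thesis .
qed

section \<open>Moment generating function and Cramer transform of the double exponential\<close>

text \<open>Against an even density only the even part cosh of the exponential contributes. This
  links the real integrals of the comparison with the extended integral inside
  \<open>log_mgf\<close>; integrability follows from the exponential being at most twice
  cosh.\<close>

lemma nn_integral_exp_even:
  fixes f :: "real \<Rightarrow> real"
  assumes [measurable]: "f \<in> borel_measurable borel" and nonneg: "\<And>x. 0 \<le> f x" and even: "\<And>x. f (- x) = f x"
    and "has_bochner_integral lborel (\<lambda>x. cosh (a * x) * f x) I"
  shows "(\<integral>\<^sup>+x. ennreal (f x) * ennreal (exp (x * a)) \<partial>lborel) = ennreal I"
proof -
  have int: "integrable lborel (\<lambda>x. cosh (a * x) * f x)" "(\<integral>x. cosh (a * x) * f x \<partial>lborel) = I"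
    using assms(4) by (simp_all add: has_bochner_integral_iff)
  have split: "cosh (a * x) * f x = (exp (x * a) * f x + exp (- x * a) * f x) / 2" for x
    by (simp add: cosh_def algebra_simps)
  have int': "integrable lborel (\<lambda>x. exp (x * a) * f x)"
  proof (rule Bochner_Integration.integrable_bound)
    show "integrable lborel (\<lambda>x. 2 * (cosh (a * x) * f x))" using int(1) by simp
    show "AE x in lborel. norm (exp (x * a) * f x) \<le> norm (2 * (cosh (a * x) * f x))"
      using nonneg by (intro AE_I2) (simp add: split)
  qed simp
  have refl: "(\<integral>x. exp (x * a) * f x \<partial>lborel) = (\<integral>x. exp (- x * a) * f x \<partial>lborel)"
    using lborel_integral_real_affine[of "-1" "\<lambda>x. exp (x * a) * f x" 0] by (simp add: even)
  have int'': "integrable lborel (\<lambda>x. exp (- x * a) * f x)"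
    using lborel_integrable_real_affine[OF int', of "-1" 0] by (simp add: even)
  have "I = (\<integral>x. (exp (x * a) * f x + exp (- x * a) * f x) / 2 \<partial>lborel)"
    using int(2) by (simp add: split)
  also have "\<dots> = (\<integral>x. exp (x * a) * f x \<partial>lborel)"
    using int' int'' refl by simp
  finally have I: "(\<integral>x. exp (x * a) * f x \<partial>lborel) = I" by simp
  have "(\<integral>\<^sup>+x. ennreal (f x) * ennreal (exp (x * a)) \<partial>lborel) = (\<integral>\<^sup>+x. ennreal (exp (x * a) * f x) \<partial>lborel)"
    using nonneg by (simp add: ennreal_mult mult.commute)
  also have "\<dots> = ennreal I"
    using nn_integral_eq_integral[OF int'] nonneg I by simp
  finally show ?thesis .
qed

lemma laplace_mgf:
  "(\<integral>\<^sup>+y. ennreal (exp (y * \<xi>)) \<partial>laplace_measure) =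
    (if \<bar>\<xi>\<bar> < 1 then ennreal (1 / (1 - \<xi>\<^sup>2)) else \<infinity>)"
proof -
  have eq: "(\<integral>\<^sup>+y. ennreal (exp (y * \<xi>)) \<partial>laplace_measure) =
      (\<integral>\<^sup>+y. ennreal (exp (- \<bar>y\<bar>) / 2) * ennreal (exp (y * \<xi>)) \<partial>lborel)"
    unfolding laplace_measure_def by (rule nn_integral_density) simp_all
  show ?thesis
  proof (cases "\<bar>\<xi>\<bar> < 1")
    case True
    then show ?thesis unfolding eq by (simp add: nn_integral_exp_even[OF _ _ _ laplace_cosh])
  next
    case False
    \<comment> \<open>The half-line on which
      \<open>y * \<xi> = \<bar>y\<bar> * \<bar>\<xi>\<bar>\<close>. There the growth of
      \<open>exp (y * \<xi>)\<close> offsets the decay of the density, and the integrand is at least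
      1/2.\<close>
    define H :: "real set" where "H = (if 0 \<le> \<xi> then {0..} else {..0})"
    have H [measurable]: "H \<in> sets borel" by (simp add: H_def)
    have "(\<integral>\<^sup>+y. ennreal (1/2) * indicator H y \<partial>lborel) \<le>
        (\<integral>\<^sup>+y. ennreal (exp (- \<bar>y\<bar>) / 2) * ennreal (exp (y * \<xi>)) \<partial>lborel)"
    proof (rule nn_integral_mono)
      fix y :: real
      show "ennreal (1/2) * indicator H y \<le> ennreal (exp (- \<bar>y\<bar>) / 2) * ennreal (exp (y * \<xi>))"
      proof (cases "y \<in> H")
        case True
        have "\<bar>y\<bar> * 1 \<le> \<bar>y\<bar> * \<bar>\<xi>\<bar>" using False by (intro mult_left_mono) auto
        also have "\<bar>y\<bar> * \<bar>\<xi>\<bar> = y * \<xi>"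
          using True by (auto simp: H_def abs_real_def split: if_splits)
        finally have "1 \<le> exp (- \<bar>y\<bar>) * exp (y * \<xi>)" by (simp add: mult_exp_exp)
        then have "ennreal (1 / 2) \<le> ennreal (exp (- \<bar>y\<bar>) / 2 * exp (y * \<xi>))"
          by (intro ennreal_leI) simp
        also have "\<dots> = ennreal (exp (- \<bar>y\<bar>) / 2) * ennreal (exp (y * \<xi>))"
          by (rule ennreal_mult) simp_all
        finally show ?thesis using True by simp
      qed simp
    qed
    \<comment> \<open>The two half-lines cover the real line and are reflections of each other, so
      each has infinite measure.\<close>
    moreover have "emeasure lborel H = \<infinity>"
    proof -
      have "{0..} \<union> {..0} = (UNIV :: real set)" by auto
      then have "emeasure lborel ({0..} \<union> {..0::real}) = \<infinity>" by simp
      then have "emeasure lborel {0::real..} + emeasure lborel {..0::real} = \<infinity>"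
        using emeasure_subadditive[of "{0::real..}" lborel "{..0::real}"] by (simp add: top_unique)
      moreover have "emeasure lborel {..0::real} = emeasure lborel {0::real..}"
      proof -
        have "emeasure lborel {0::real..} = (\<integral>\<^sup>+x. indicator {0::real..} x \<partial>lborel)" by simp
        also have "\<dots> = (\<integral>\<^sup>+x. indicator {0::real..} (0 + (-1) * x) \<partial>lborel)"
          by (subst nn_integral_real_affine[of _ "-1" 0]) simp_all
        also have "(\<lambda>x. indicator {0::real..} (0 + (-1) * x) :: ennreal) = indicator {..0}"
          by (auto split: split_indicator)
        finally show ?thesis by simp
      qed
      ultimately show ?thesis by (auto simp: H_def)
    qed
    ultimately show ?thesis
      unfolding eq using False by (simp add: nn_integral_cmult_indicator ennreal_mult_top top_unique)
  qed
qed

text \<open>For \<open>\<bar>\<xi>\<bar> \<ge> 1\<close> the term of the supremum is minus infinity.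
  Within the open interval \<open>dual_bound\<close> bounds the terms and \<open>dual_point\<close>
  attains the bound.\<close>

lemma cramer_laplace: "cramer laplace_measure (\<lambda>y. y) x = ereal (- ln (laplace_weight (x\<^sup>2)))"
proof -
  have L: "log_mgf laplace_measure (\<lambda>y. y) \<xi> = (if \<bar>\<xi>\<bar> < 1 then ereal (- ln (1 - \<xi>\<^sup>2)) else \<infinity>)" for \<xi> :: real
  proof (cases "\<bar>\<xi>\<bar> < 1")
    case True
    then have "0 < 1 - \<xi>\<^sup>2" by (simp add: abs_square_less_1)
    then have "ln (enn2real (ennreal (1 / (1 - \<xi>\<^sup>2)))) = - ln (1 - \<xi>\<^sup>2)"
      by (simp add: ln_div)
    then show ?thesis
      using True by (simp add: log_mgf_def laplace_mgf Let_def)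
  qed (simp add: log_mgf_def laplace_mgf Let_def)
  show ?thesis
    unfolding cramer_def
  proof (rule antisym)
    show "(SUP \<xi>. ereal (x \<bullet> \<xi>) - log_mgf laplace_measure (\<lambda>y. y) \<xi>) \<le> ereal (- ln (laplace_weight (x\<^sup>2)))"
      using dual_bound[of _ x] by (intro SUP_least) (auto simp: L)
    have "ereal (- ln (laplace_weight (x\<^sup>2))) = ereal (x \<bullet> dual_point x) - log_mgf laplace_measure (\<lambda>y. y) (dual_point x)"
      using dual_point_identities(3)[of x] dual_point_attains[of x] by (simp add: L)
    also have "\<dots> \<le> (SUP \<xi>. ereal (x \<bullet> \<xi>) - log_mgf laplace_measure (\<lambda>y. y) \<xi>)"
      by (rule SUP_upper) simp
    finally show "ereal (- ln (laplace_weight (x\<^sup>2))) \<le> (SUP \<xi>. ereal (x \<bullet> \<xi>) - log_mgf laplace_measure (\<lambda>y. y) \<xi>)" .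
  qed
qed

lemma integrable_laplace_weight:
  "integrable lborel (\<lambda>x. laplace_weight (x\<^sup>2) * (exp (- \<bar>x\<bar>) / 2))"
proof (rule Bochner_Integration.integrable_bound)
  show "integrable lborel (\<lambda>x::real. exp (- \<bar>x\<bar>) / 2)"
    using laplace_cosh[of 0] by (simp add: has_bochner_integral_iff)
  show "AE x in lborel. norm (laplace_weight (x\<^sup>2) * (exp (- \<bar>x\<bar>) / 2)) \<le> norm (exp (- \<bar>x\<bar>) / 2)"
  proof (rule AE_I2)
    fix x :: real
    have "\<bar>laplace_weight (x\<^sup>2)\<bar> \<le> 1" using laplace_weight_nonneg[of "x\<^sup>2"] laplace_weight_le_1[of "x\<^sup>2"] by simp
    then show "norm (laplace_weight (x\<^sup>2) * (exp (- \<bar>x\<bar>) / 2)) \<le> norm (exp (- \<bar>x\<bar>) / 2)"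
      by (simp add: abs_mult)
  qed
qed simp

lemma cramer_exp_laplace:
  "cramer_exp laplace_measure (\<lambda>y. y) = (\<integral>x. laplace_weight (x\<^sup>2) * (exp (- \<bar>x\<bar>) / 2) \<partial>lborel)"
proof -
  have "exp_neg (cramer laplace_measure (\<lambda>y. y) x) = laplace_weight (x\<^sup>2)" for x
    using laplace_weight_pos[of "x\<^sup>2"] by (simp add: cramer_laplace exp_neg_def)
  then have "cramer_exp laplace_measure (\<lambda>y. y) = (\<integral>x. laplace_weight (x\<^sup>2) \<partial>laplace_measure)"
    by (simp add: cramer_exp_def)
  also have "\<dots> = (\<integral>x. (exp (- \<bar>x\<bar>) / 2) *\<^sub>R laplace_weight (x\<^sup>2) \<partial>lborel)"
    unfolding laplace_measure_def by (rule integral_density) simp_all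
  finally show ?thesis by (simp add: mult.commute)
qed

section \<open>One coordinate compared with a rescaled double exponential\<close>

text \<open>The convex order of the squares is applied to two test functions: cosh of a square root
  for the moment generating function, and the rescaled weight for the final expectation. The range
  \<open>\<bar>\<xi>\<bar> < 1\<close> contains every \<open>dual_point\<close>.\<close>

lemma log_concave_vs_laplace:
  fixes f :: "real \<Rightarrow> real"
  assumes lc: "log_concave f" and even: "\<And>x. f (- x) = f x" and f: "has_bochner_integral lborel f 1"
  obtains l where "0 < l"
    and "\<And>\<xi>. \<bar>\<xi>\<bar> < 1 \<Longrightarrow> (\<integral>\<^sup>+x. ennreal (f x) * ennreal (exp (x * (l * \<xi>))) \<partial>lborel) \<le> ennreal (1 / (1 - \<xi>\<^sup>2))"
    and "(\<integral>x. f x * laplace_weight ((l * x)\<^sup>2) \<partial>lborel) \<le> cramer_exp laplace_measure (\<lambda>y. y)"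
proof -
  have int: "integrable lborel f" "(\<integral>x. f x \<partial>lborel) = 1"
    using f by (simp_all add: has_bochner_integral_iff)
  have [measurable]: "f \<in> borel_measurable borel"
    using borel_measurable_integrable[OF int(1)] by simp
  note nonneg = log_concaveD(1)[OF lc]
  note second = log_concave_even_second_moment[OF lc even int(1)]
  define V where "V = (\<integral>x. x\<^sup>2 * f x \<partial>lborel)"
  have V: "0 < V" "integrable lborel (\<lambda>x. x\<^sup>2 * f x)" using second int by (simp_all add: V_def)
  \<comment> \<open>The double exponential Y has second moment 2, so Y / l has second moment
    \<open>2 / l^2 = V\<close>, that of \<open>f\<close>. Its density is \<open>g\<close>
    below.\<close>
  define l where "l = sqrt (2 / V)"
  have l: "0 < l" using V by (simp add: l_def)
  have l2: "2 / l\<^sup>2 = V" using V by (simp add: l_def)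
  define g where "g x = l * exp (- (l * \<bar>x\<bar>)) / 2" for x
  have g0: "has_bochner_integral lborel g 1"
    using laplace_scale[OF l laplace_cosh[of 0]] by (simp add: g_def[abs_def])
  have "has_bochner_integral lborel (\<lambda>x. (l * x)\<^sup>2 * g x) 2"
    unfolding g_def by (rule laplace_scale[OF l laplace_second_moment])
  from has_bochner_integral_divide_zero[OF this, of "l\<^sup>2"]
  have g2: "has_bochner_integral lborel (\<lambda>x. x\<^sup>2 * g x) V"
    using l by (simp add: power_mult_distrib l2)
  have cross: "convex {x. 0 \<le> x \<and> g x \<le> f x}"
    using log_concave_above_exponential_convex[OF lc, of "l / 2" l] l by (simp add: g_def)
  have comparison: "integrable lborel (\<lambda>x. \<phi> (x\<^sup>2) * f x) \<and> (\<integral>x. \<phi> (x\<^sup>2) * f x \<partial>lborel) \<le> J"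
    if "convex_on {0..} \<phi>" "\<And>u. 0 \<le> u \<Longrightarrow> 0 \<le> \<phi> u" "(\<lambda>x. \<phi> (x\<^sup>2)) \<in> borel_measurable borel"
      "has_bochner_integral lborel (\<lambda>x. \<phi> (x\<^sup>2) * g x) J" for \<phi> J
  proof -
    have "integrable lborel (\<lambda>x. \<phi> (x\<^sup>2) * g x)" "(\<integral>x. \<phi> (x\<^sup>2) * g x \<partial>lborel) = J"
      using that(4) by (simp_all add: has_bochner_integral_iff)
    moreover have "integrable lborel g" "(\<integral>x. g x \<partial>lborel) = 1"
        "integrable lborel (\<lambda>x. x\<^sup>2 * g x)" "(\<integral>x. x\<^sup>2 * g x \<partial>lborel) = V"
      using g0 g2 by (simp_all add: has_bochner_integral_iff)
    moreover have "g (- x) = g x" for x by (simp add: g_def)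
    ultimately show ?thesis
      using convex_order_of_squares[of f g \<phi>] int V nonneg even cross that(1-3) by (simp add: V_def[symmetric])
  qed
  have mgf: "(\<integral>\<^sup>+x. ennreal (f x) * ennreal (exp (x * (l * \<xi>))) \<partial>lborel) \<le> ennreal (1 / (1 - \<xi>\<^sup>2))"
    if "\<bar>\<xi>\<bar> < 1" for \<xi>
  proof -
    have arg: "\<xi> * (l * x) = l * \<xi> * x" for x :: real by simp
    \<comment> \<open>\<open>sqrt (x^2)\<close> is \<open>\<bar>x\<bar>\<close>, and cosh is
      even.\<close>
    have sq: "cosh (l * \<xi> * sqrt (x\<^sup>2)) = cosh (l * \<xi> * x)" for x :: real
      by (cases "0 \<le> x") simp_all
    have "has_bochner_integral lborel (\<lambda>x. cosh (\<xi> * (l * x)) * g x) (1 / (1 - \<xi>\<^sup>2))"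
      unfolding g_def by (rule laplace_scale[OF l laplace_cosh[OF that]])
    then have cg: "has_bochner_integral lborel (\<lambda>x. cosh (l * \<xi> * sqrt (x\<^sup>2)) * g x) (1 / (1 - \<xi>\<^sup>2))"
      unfolding sq arg .
    have "integrable lborel (\<lambda>x. cosh (l * \<xi> * sqrt (x\<^sup>2)) * f x) \<and>
        (\<integral>x. cosh (l * \<xi> * sqrt (x\<^sup>2)) * f x \<partial>lborel) \<le> 1 / (1 - \<xi>\<^sup>2)"
      by (rule comparison[OF convex_on_cosh_sqrt _ _ cg])
         (auto intro!: borel_measurable_continuous_onI continuous_intros)
    then have cf: "integrable lborel (\<lambda>x. cosh (l * \<xi> * x) * f x)"
        "(\<integral>x. cosh (l * \<xi> * x) * f x \<partial>lborel) \<le> 1 / (1 - \<xi>\<^sup>2)"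
      by (simp_all only: sq)
    have "(\<integral>\<^sup>+x. ennreal (f x) * ennreal (exp (x * (l * \<xi>))) \<partial>lborel) =
        ennreal (\<integral>x. cosh (l * \<xi> * x) * f x \<partial>lborel)"
      by (rule nn_integral_exp_even) (use nonneg even cf(1) in \<open>simp_all add: has_bochner_integral_iff\<close>)
    then show ?thesis using cf(2) by (simp add: ennreal_leI)
  qed
  \<comment> \<open>Second test function, \<open>laplace_weight (l^2 * u)\<close>: under
    \<open>g\<close> the scaling cancels and the expectation is the constant of Y itself.\<close>
  have "has_bochner_integral lborel (\<lambda>x. laplace_weight (x\<^sup>2) * (exp (- \<bar>x\<bar>) / 2)) (cramer_exp laplace_measure (\<lambda>y. y))"
    using integrable_laplace_weight by (simp add: cramer_exp_laplace has_bochner_integral_iff)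
  from laplace_scale[OF l this]
  have "has_bochner_integral lborel (\<lambda>x. laplace_weight (l\<^sup>2 * x\<^sup>2) * g x) (cramer_exp laplace_measure (\<lambda>y. y))"
    by (simp add: g_def power_mult_distrib)
  then have "(\<integral>x. laplace_weight (l\<^sup>2 * x\<^sup>2) * f x \<partial>lborel) \<le> cramer_exp laplace_measure (\<lambda>y. y)"
    by (intro comparison[THEN conjunct2] convex_on_laplace_weight_scaled) (simp_all add: laplace_weight_nonneg)
  then have "(\<integral>x. f x * laplace_weight ((l * x)\<^sup>2) \<partial>lborel) \<le> cramer_exp laplace_measure (\<lambda>y. y)"
    by (simp add: power_mult_distrib mult.commute)
  with l mgf show thesis by (rule that)
qed

section \<open>From one coordinate to independent coordinates\<close>

lemma exp_neg_antimono: "ereal r \<le> c \<Longrightarrow> exp_neg c \<le> exp (- r)"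
  by (cases c) (simp_all add: exp_neg_def)

lemma prod_mono_ennreal:
  fixes a b :: "'a \<Rightarrow> ennreal"
  assumes "\<And>i. i \<in> A \<Longrightarrow> a i \<le> b i"
  shows "(\<Prod>i\<in>A. a i) \<le> (\<Prod>i\<in>A. b i)"
  using assms by (induction A rule: infinite_finite_induct) (auto intro!: mult_mono)

theorem theorem1p3:
  fixes M :: "'s measure" and X :: "'s \<Rightarrow> real ^ 'n" and f :: "'n \<Rightarrow> real \<Rightarrow> real"
  assumes "prob_space M"
    and "X \<in> borel_measurable M"
    and "prob_space.indep_vars M (\<lambda>_. borel) (\<lambda>i \<omega>. X \<omega> $ i) UNIV"
    and "\<And>i. distributed M lborel (\<lambda>\<omega>. X \<omega> $ i) (\<lambda>x. ennreal (f i x))"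
    and "\<And>i. log_concave (f i)"
    and "\<And>i x. f i (- x) = f i x"
  shows "cramer_exp M X \<le> (cramer_exp laplace_measure (\<lambda>y. y)) ^ CARD('n)"
proof -
  interpret prob_space M by fact
  note indep = assms(3) and dist = assms(4)
  have nonneg: "0 \<le> f i x" for i x using log_concaveD(1)[OF assms(5)] .
  have f_meas [measurable]: "f i \<in> borel_measurable borel" for i
    using distributed_real_measurable[OF _ dist[of i]] nonneg by simp
  have f_int: "has_bochner_integral lborel (f i) 1" for i
  proof (rule has_bochner_integral_nn_integral)
    have "(\<integral>\<^sup>+x. ennreal (f i x) * 1 \<partial>lborel) = (\<integral>\<^sup>+\<omega>. 1 \<partial>M)"
      by (rule distributed_nn_integral[OF dist]) simp
    then show "(\<integral>\<^sup>+x. ennreal (f i x) \<partial>lborel) = ennreal 1" by (simp add: emeasure_space_1)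
  qed (simp_all add: nonneg)
  \<comment> \<open>Each coordinate receives its own scale, since the second moments may
    differ.\<close>
  have "\<exists>l. \<forall>i. 0 < l i \<and>
      (\<forall>\<xi>. \<bar>\<xi>\<bar> < 1 \<longrightarrow> (\<integral>\<^sup>+x. ennreal (f i x) * ennreal (exp (x * (l i * \<xi>))) \<partial>lborel) \<le> ennreal (1 / (1 - \<xi>\<^sup>2))) \<and>
      (\<integral>x. f i x * laplace_weight ((l i * x)\<^sup>2) \<partial>lborel) \<le> cramer_exp laplace_measure (\<lambda>y. y)"
  proof (intro choice allI)
    fix i
    show "\<exists>l. 0 < l \<and>
      (\<forall>\<xi>. \<bar>\<xi>\<bar> < 1 \<longrightarrow> (\<integral>\<^sup>+x. ennreal (f i x) * ennreal (exp (x * (l * \<xi>))) \<partial>lborel) \<le> ennreal (1 / (1 - \<xi>\<^sup>2))) \<and>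
      (\<integral>x. f i x * laplace_weight ((l * x)\<^sup>2) \<partial>lborel) \<le> cramer_exp laplace_measure (\<lambda>y. y)"
      by (rule log_concave_vs_laplace[OF assms(5)[of i] assms(6) f_int]) (intro exI conjI allI impI)
  qed
  then obtain l where l: "\<And>i. 0 < l i"
    and mgf: "\<And>i \<xi>. \<bar>\<xi>\<bar> < 1 \<Longrightarrow> (\<integral>\<^sup>+x. ennreal (f i x) * ennreal (exp (x * (l i * \<xi>))) \<partial>lborel) \<le> ennreal (1 / (1 - \<xi>\<^sup>2))"
    and expectation_weight: "\<And>i. (\<integral>x. f i x * laplace_weight ((l i * x)\<^sup>2) \<partial>lborel) \<le> cramer_exp laplace_measure (\<lambda>y. y)"
    by blast
  \<comment> \<open>A lower bound on the supremum in \<open>cramer\<close> comes from a single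
    \<open>\<xi>\<close>, whose coordinates are the optimal points for the rescaled double
    exponentials.\<close>
  have bound: "exp_neg (cramer M X x) \<le> (\<Prod>i\<in>UNIV. laplace_weight ((l i * x $ i)\<^sup>2))" for x :: "real ^ 'n"
  proof -
    define p where "p i = dual_point (l i * x $ i)" for i
    define \<xi> :: "real ^ 'n" where "\<xi> = (\<chi> i. l i * p i)"
    have p: "\<bar>p i\<bar> < 1" for i by (simp add: p_def dual_point_identities(3))
    have pos: "0 < 1 - (p i)\<^sup>2" "1 - (p i)\<^sup>2 \<le> 1" for i using p[of i] by (simp_all add: abs_square_less_1)
    define C where "C = (\<Prod>i\<in>UNIV. 1 / (1 - (p i)\<^sup>2))"
    have C: "1 \<le> C" unfolding C_def using pos by (intro prod_ge_1) simp
    define m where "m = (\<integral>\<^sup>+\<omega>. ennreal (exp (X \<omega> \<bullet> \<xi>)) \<partial>M)"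
    have "m = (\<integral>\<^sup>+\<omega>. (\<Prod>i\<in>UNIV. ennreal (exp (X \<omega> $ i * (l i * p i)))) \<partial>M)"
      by (simp add: m_def inner_vec_def \<xi>_def exp_sum prod_ennreal)
    also have "\<dots> = (\<Prod>i\<in>UNIV. \<integral>\<^sup>+\<omega>. ennreal (exp (X \<omega> $ i * (l i * p i))) \<partial>M)"
      by (rule indep_vars_nn_integral[OF _ indep_vars_compose2[OF indep]]) simp_all
    also have "\<dots> = (\<Prod>i\<in>UNIV. \<integral>\<^sup>+x. ennreal (f i x) * ennreal (exp (x * (l i * p i))) \<partial>lborel)"
      by (intro prod.cong refl distributed_nn_integral[OF dist, symmetric]) simp
    also have "\<dots> \<le> (\<Prod>i\<in>UNIV. ennreal (1 / (1 - (p i)\<^sup>2)))"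
      by (intro prod_mono_ennreal mgf p)
    also have "\<dots> = ennreal C" unfolding C_def using pos by (intro prod_ennreal) (simp add: less_imp_le)
    finally have m: "m \<le> ennreal C" .
    then have fin: "m \<noteq> \<infinity>" by (auto simp: top_unique)
    have "enn2real m \<le> C" using m C by (intro enn2real_leI) auto
    \<comment> \<open>The value 0 is covered by the default \<open>ln 0 = 0\<close> together with
      \<open>1 \<le> C\<close>.\<close>
    then have "ln (enn2real m) \<le> ln C"
      using C by (cases "enn2real m = 0") (auto simp: ln_le_cancel_iff less_le)
    then have "log_mgf M X \<xi> \<le> ereal (ln C)"
      using fin by (simp add: log_mgf_def m_def Let_def)
    then have "ereal (x \<bullet> \<xi>) - ereal (ln C) \<le> ereal (x \<bullet> \<xi>) - log_mgf M X \<xi>"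
      by (intro ereal_minus_mono) simp_all
    also have "\<dots> \<le> cramer M X x" unfolding cramer_def by (rule SUP_upper) simp
    finally have "ereal (x \<bullet> \<xi> - ln C) \<le> cramer M X x" by simp
    then have "exp_neg (cramer M X x) \<le> exp (- (x \<bullet> \<xi> - ln C))" by (rule exp_neg_antimono)
    \<comment> \<open>The exponent is a sum over coordinates, and in each of them
      \<open>dual_point_attains\<close> gives the logarithm of the weight.\<close>
    also have "- (x \<bullet> \<xi> - ln C) = (\<Sum>i\<in>UNIV. ln (laplace_weight ((l i * x $ i)\<^sup>2)))"
    proof -
      have "ln C = (\<Sum>i\<in>UNIV. - ln (1 - (p i)\<^sup>2))"
        unfolding C_def using pos by (subst ln_prod) (simp_all add: ln_div less_imp_neq[symmetric])
      moreover have "x \<bullet> \<xi> = (\<Sum>i\<in>UNIV. (l i * x $ i) * p i)"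
        by (simp add: inner_vec_def \<xi>_def mult_ac)
      ultimately have "- (x \<bullet> \<xi> - ln C) = (\<Sum>i\<in>UNIV. - ((l i * x $ i) * p i + ln (1 - (p i)\<^sup>2)))"
        by (simp add: sum_negf sum.distrib sum_subtractf)
      also have "\<dots> = (\<Sum>i\<in>UNIV. ln (laplace_weight ((l i * x $ i)\<^sup>2)))"
        by (simp only: p_def dual_point_attains minus_minus)
      finally show ?thesis .
    qed
    also have "exp \<dots> = (\<Prod>i\<in>UNIV. laplace_weight ((l i * x $ i)\<^sup>2))"
      by (simp add: exp_sum laplace_weight_pos)
    finally show ?thesis .
  qed
  have weight_ind: "indep_vars (\<lambda>_. borel) (\<lambda>i \<omega>. laplace_weight ((l i * X \<omega> $ i)\<^sup>2)) UNIV"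
    by (rule indep_vars_compose2[OF indep]) simp
  have weight_int: "integrable M (\<lambda>\<omega>. laplace_weight ((l i * X \<omega> $ i)\<^sup>2))" for i
  proof (rule integrable_const_bound[where B = 1])
    have [measurable]: "(\<lambda>\<omega>. X \<omega> $ i) \<in> borel_measurable M"
      using distributed_measurable[OF dist[of i]] by simp
    show "(\<lambda>\<omega>. laplace_weight ((l i * X \<omega> $ i)\<^sup>2)) \<in> borel_measurable M" by measurable
  qed (simp add: laplace_weight_nonneg laplace_weight_le_1)
  \<comment> \<open>\<open>integral_mono'\<close> asks for integrability of the larger function and
    its nonnegativity; a non-integrable left side would have the default integral 0.\<close>
  have "cramer_exp M X \<le> (\<integral>\<omega>. (\<Prod>i\<in>UNIV. laplace_weight ((l i * X \<omega> $ i)\<^sup>2)) \<partial>M)"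
    unfolding cramer_exp_def
    by (rule integral_mono'[OF indep_vars_integrable[OF _ weight_ind weight_int]]) (simp_all add: bound prod_nonneg laplace_weight_nonneg)
  also have "\<dots> = (\<Prod>i\<in>UNIV. \<integral>\<omega>. laplace_weight ((l i * X \<omega> $ i)\<^sup>2) \<partial>M)"
    by (rule indep_vars_lebesgue_integral[OF _ weight_ind weight_int]) simp
  also have "\<dots> = (\<Prod>i\<in>UNIV. \<integral>x. f i x * laplace_weight ((l i * x)\<^sup>2) \<partial>lborel)"
    by (intro prod.cong refl distributed_integral[OF dist, symmetric]) (simp_all add: nonneg)
  also have "\<dots> \<le> (\<Prod>i\<in>(UNIV::'n set). cramer_exp laplace_measure (\<lambda>y. y))"
    by (intro prod_mono conjI expectation_weight Bochner_Integration.integral_nonneg mult_nonneg_nonneg nonneg laplace_weight_nonneg) simp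
  finally show ?thesis by simp
qed

end
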